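(* Let $G$ be a zero-sum stochastic reachability game with partially controllable observation function, and let $\mathcal{G}$ be its belief-augmented game (both as defined in the context). Let $\pi_1$ be a belief-based almost-sure winning strategy of P1 for reaching $\{q_F\}$ in $\mathcal{G}$ (from the initial state $q_0$). Then $\pi_1$, played in $G$ according to P1's current belief, is almost-surely winning for P1 to visit $F$ in $G$: regardless of the sensor attack strategy carried out by P2, the play of $G$ visits $F$ with probability one.
   Context: For a finite set $X$, $\mathcal{D}(X)$ is the set of probability distributions on $X$ and $\mathsf{Supp}(d)$ is the support of $d$. **Game $G$.** A zero-sum stochastic reachability game with partially controllable observation function is $G=\langle S,A,P,s_0,\Gamma,\Sigma\times\mathcal{B},\mathcal{O},\mathsf{Obs},o_0,F\rangle$, where: $S$ is a finite set of states; $A$ is a finite set of control actions of player 1 (P1); $P:S\times A\to\mathcal{D}(S)$ is the transition function, with $P(s,a,s')$ the probability of moving from $s$ to $s'$ under $a$; $s_0\in S$ is the initial state; $\Gamma=\{0,1,\dots,N\}$ is a set of sensors, sensor $i$ covering a set $S_i\subseteq S$; $\Sigma\subseteq 2^\Gamma$ is the set of P1's sensor query actions; $\mathcal{B}\subseteq 2^\Gamma$ is the set of sensor attack actions of player 2 (P2), each blocking a subset of sensors; $\mathcal{O}\subseteq 2^S$ is the set of observations; $o_0\in\mathcal{O}$ is the initial observation and $s_0\in o_0$; $F\subseteq S$ is the set of final states. At state $s$, sensor $i$ returns $v_i=\mathsf{True}$ if $s\in S_i$ and $v_i=\mathsf{False}$ otherwise. The observation function $\mathsf{Obs}:S\times\Sigma\times\mathcal{B}\to\mathcal{O}$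 is $$\mathsf{Obs}(s,\sigma,\beta)=S\setminus\Big(\bigcup_{i\in\sigma\setminus\beta,\ v_i=\mathsf{True}}(S\setminus S_i)\ \cup\bigcup_{i\in\sigma\setminus\beta,\ v_i=\mathsf{False}}S_i\Big).$$ For $B\subseteq S$, $a\in A$: $\mathsf{Post}_G(B,a)=\{s'\in S\mid \exists s\in B:\ P(s,a,s')>0\}$, and $\mathsf{Post}_G(s,a)=\mathsf{Post}_G(\{s\},a)$. **Play in $G$.** Starting from $s_0$ with observation $o_0$, at each step $k\ge 0$ P1 selects (possibly at random) a pair $(a_k,\sigma_k)\in A\times\Sigma$; the state moves to $s_{k+1}$ with probability $P(s_k,a_k,s_{k+1})$; P2, who observes all states and all of P1's actions, selects (possibly at random, depending on the whole history including $s_{k+1}$ and $(a_k,\sigma_k)$) an attack $\beta_k\in\mathcal{B}$; P1 then observes $o_{k+1}=\mathsf{Obs}(s_{k+1},\sigma_k,\beta_k)$ and knows $\beta_k$. P1 does not observe the state itself. A play visits $F$ if $s_k\in F$ for some $k\ge0$. P1's belief along the play is $B_0=o_0$, $B_{k+1}=\mathsf{Post}_G(B_k,a_k)\cap o_{k+1}$. **Augmented game $\mathcal{G}$.** $\mathcal{G}=\langle Q\cup\{q_F\},\mathcal{A}_1\cup\mathcal{A}_2,\delta,q_0,q_F\rangle$ with $\mathcal{A}_1=A\times\Sigma$ (P1's actions), $\mathcal{A}_2=\mathcal{B}$ (P2's actions), $Q=Q_1\cup Q_N\cup Q_2$, where $Q_1=\{(s,B)\mid s\in S,B\subseteq S\}$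 are P1's states, $Q_N=\{(s,B,a,\sigma)\mid s\in S,B\subseteq S,(a,\sigma)\in\mathcal{A}_1\}$ are nature's states, and $Q_2=\{(s,B,\sigma)\mid s\in S,B\subseteq S,\sigma\in\Sigma\}$ are P2's states. The initial state is $q_0=(s_0,o_0)$; $q_F$ is an absorbing (sink) final state. The transition function $\delta$ is: - At $(s,B)\in Q_1$ with action $(a,\sigma)$: move with probability 1 to $(s,B',a,\sigma)$ where $B'=\mathsf{Post}_G(B,a)$. - At $(s,B',a,\sigma)\in Q_N$: (1) if $\mathsf{Post}_G(s,a)\subseteq F$, move to $q_F$ with probability 1; (2) if $\mathsf{Post}_G(s,a)\cap F=\emptyset$, move to $(s',B',\sigma)$ with probability $P(s,a,s')$; (3) if $\mathsf{Post}_G(s,a)\cap F\neq\emptyset$ and $\mathsf{Post}_G(s,a)\setminus F\neq\emptyset$, then, for some fixed $\epsilon\in(0,1)$, move to $q_F$ with probability $\epsilon$, and with the remaining probability $1-\epsilon$ move to the states $(s',B',\sigma)$ with $s'\in\mathsf{Post}_G(s,a)\setminus F$, each of which receives positive probability. - At $(s',B',\sigma)\in Q_2$ with attack $\beta$: move with probability 1 to $(s',B'')\in Q_1$ where $B''=B'\cap\mathsf{Obs}(s',\sigma,\beta)$. **Strategies in $\mathcal{G}$.** A strategy $\pi_1:Q_1\to\mathcal{D}(\mathcal{A}_1)$ of P1 is *belief-based* if $\pi_1((s,B))=\pi_1((s',B'))$ whenever $B=B'$; so $\pi_1$ is a function of the belief $B$ only, and playing it in $G$ means drawing $(a_k,\sigma_k)$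 from the distribution $\pi_1$ assigns to the belief $B_k$. P2 may use any (history-dependent, randomized) strategy with perfect observation of $\mathcal{G}$. $\pi_1$ is *almost-sure winning* (from a given state) if, when P1 follows $\pi_1$, $q_F$ is reached with probability one regardless of P2's strategy. *)

theory Defs
  imports "HOL-Probability.Probability"
begin

section \<open>The probability measure on infinite plays\<close>

text \<open>
  A kernel \<open>K\<close> gives, for every finite history, the distribution of the next event of a play.
  The induced measure on infinite plays is the Ionescu-Tulcea limit. The lemmas
  \<open>prob_space_play_measure\<close> and \<open>emeasure_play_measure_cylinder\<close> below confirm that it is a
  probability measure with the expected values on cylinders.
\<close>

definition next_event :: "('p list \<Rightarrow> 'p pmf) \<Rightarrow> nat \<Rightarrow> (nat \<Rightarrow> 'p) \<Rightarrow> 'p measure" where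
  "next_event K n \<omega> = measure_pmf (K (map \<omega> [0..<n]))"

definition play_measure :: "('p::countable list \<Rightarrow> 'p pmf) \<Rightarrow> (nat \<Rightarrow> 'p) measure" where
  "play_measure K =
     projective_family.lim UNIV
       (Ionescu_Tulcea.CI (next_event K) (\<lambda>_. count_space UNIV)) (\<lambda>_. count_space UNIV)"

lemma PiM_count_space_initial:
  "PiM {0..<n::nat} (\<lambda>_. count_space (UNIV :: 'p::countable set))
     = count_space (PiE {0..<n} (\<lambda>_. UNIV))"
  by (rule count_space_PiM_finite) auto

lemma Ionescu_Tulcea_next_event:
  "Ionescu_Tulcea (next_event K) (\<lambda>_. count_space (UNIV :: 'p::countable set))"
proof (rule Ionescu_Tulcea.intro)
  show "next_event K n \<in> measurable (PiM {0..<n} (\<lambda>_. count_space UNIV))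
          (subprob_algebra (count_space UNIV))" for n
    unfolding PiM_count_space_initial next_event_def
    by (auto simp: space_subprob_algebra intro!: prob_space_imp_subprob_space
        prob_space_measure_pmf)
  show "prob_space (next_event K n \<omega>)" for n \<omega>
    unfolding next_event_def by (rule prob_space_measure_pmf)
qed

lemma sets_play_measure:
  "sets (play_measure K) = sets (PiM UNIV (\<lambda>_. count_space UNIV))"
proof -
  interpret IT: Ionescu_Tulcea "next_event K" "\<lambda>_. count_space UNIV"
    by (rule Ionescu_Tulcea_next_event)
  show ?thesis
    unfolding play_measure_def by simp
qed

lemma space_play_measure: "space (play_measure K) = UNIV"
  using sets_eq_imp_space_eq[OF sets_play_measure[of K]] by (simp add: space_PiM)

lemma emeasure_play_measure_cylinder:
  "emeasure (play_measure K) {\<omega>. \<forall>i<n. \<omega> i = p i}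
     = (\<Prod>i<n. ennreal (pmf (K (map p [0..<i])) (p i)))"
proof -
  let ?M = "\<lambda>_::nat. count_space (UNIV :: 'a set)"
  interpret IT: Ionescu_Tulcea "next_event K" ?M
    by (rule Ionescu_Tulcea_next_event)
  define X where "X n = {restrict p {0..<n}}" for n
  have X: "X n \<in> sets (PiM {0..<n} ?M)" for n
    by (simp add: X_def PiM_count_space_initial)
  have C: "emeasure (IT.C 0 n (\<lambda>_. undefined)) (X n)
      = (\<Prod>i<n. ennreal (pmf (K (map p [0..<i])) (p i)))" for n
  proof (induction n)
    case 0
    then show ?case
      using X[of 0] by (simp add: X_def restrict_def)
  next
    case (Suc n)
    let ?C = "IT.C 0 n (\<lambda>_. undefined)"
    let ?p = "pmf (K (map p [0..<n])) (p n)"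
    have u: "(\<lambda>_. undefined) \<in> space (PiM {0..<0} ?M)"
      by (simp add: space_PiM)
    have step: "emeasure (IT.eP n \<omega>) (X (Suc n)) = ennreal ?p * indicator (X n) \<omega>"
      if \<omega>: "\<omega> \<in> space (PiM {0..<n} ?M)" for \<omega>
    proof -
      have ext: "\<omega> \<in> extensional {0..<n}"
        using \<omega> by (auto simp: space_PiM PiE_def)
      have upd: "fun_upd \<omega> n x = restrict p {0..<Suc n}
          \<longleftrightarrow> \<omega> = restrict p {0..<n} \<and> x = p n" for x
      proof
        assume eq: "fun_upd \<omega> n x = restrict p {0..<Suc n}"
        have "x = p n"
          using fun_cong[OF eq, of n] by simp
        moreover have "\<omega> i = restrict p {0..<n} i" for i
          using fun_cong[OF eq, of i] ext
          by (cases "i = n") (auto simp: extensional_def restrict_def split: if_splits)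
        ultimately show "\<omega> = restrict p {0..<n} \<and> x = p n"
          by auto
      qed (auto simp: fun_eq_iff)
      have "(\<lambda>x. fun_upd \<omega> n x) -` X (Suc n) \<inter> space (?M n)
          = (if \<omega> \<in> X n then {p n} else {})"
        using upd by (auto simp: X_def)
      moreover have "map \<omega> [0..<n] = map p [0..<n]" if "\<omega> \<in> X n"
        using that by (simp add: X_def)
      ultimately have
        "emeasure (IT.eP n \<omega>) (X (Suc n)) = emeasure (next_event K n \<omega>) (if \<omega> \<in> X n then {p n} else {})"
        and "\<omega> \<in> X n \<Longrightarrow> next_event K n \<omega> = measure_pmf (K (map p [0..<n]))"
        using IT.emeasure_eP[OF \<omega> X[of "Suc n"]] by (simp_all only: next_event_def)
      then show ?thesis
        by (cases "\<omega> \<in> X n") (simp_all add: emeasure_pmf_single)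
    qed
    have meas: "IT.eP n \<in> measurable ?C (subprob_algebra (PiM {0..<Suc n} ?M))"
      using IT.measurable_eP[of n] IT.sets_C[OF u, of n]
      by (simp cong: measurable_cong_sets)
    have "emeasure (IT.C 0 (Suc n) (\<lambda>_. undefined)) (X (Suc n))
        = (\<integral>\<^sup>+\<omega>. emeasure (IT.eP n \<omega>) (X (Suc n)) \<partial>?C)"
      using IT.space_C[OF u, of n] meas X[of "Suc n"]
      by (simp, subst emeasure_bind) auto
    also have "\<dots> = (\<integral>\<^sup>+\<omega>. ennreal ?p * indicator (X n) \<omega> \<partial>?C)"
      using IT.space_C[OF u, of n] by (intro nn_integral_cong step) simp
    also have "\<dots> = ennreal ?p * emeasure ?C (X n)"
      using X[of n] IT.sets_C[OF u, of n] by (simp add: nn_integral_cmult_indicator)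
    finally show ?case
      using Suc.IH by (simp add: mult.commute)
  qed
  have "{\<omega>. \<forall>i<n. \<omega> i = p i} = prod_emb UNIV ?M {0..<n} (X n)"
    by (auto simp: prod_emb_def X_def fun_eq_iff restrict_def space_PiM split: if_splits)
  then have "emeasure (play_measure K) {\<omega>. \<forall>i<n. \<omega> i = p i} = emeasure (IT.CI {0..<n}) (X n)"
    unfolding play_measure_def using IT.lim[OF _ X[of n]] by simp
  also have "\<dots> = emeasure (IT.C 0 n (\<lambda>_. undefined)) (prod_emb {0..<n} ?M {0..<n} (X n))"
    by (rule IT.emeasure_CI[OF subset_refl X])
  also have "prod_emb {0..<n} ?M {0..<n} (X n) = X n"
    using sets.sets_into_space[OF X[of n]] by (intro prod_emb_id) (auto simp: space_PiM)
  finally show ?thesis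
    by (simp add: C)
qed

lemma prob_space_play_measure: "prob_space (play_measure K)"
  using emeasure_play_measure_cylinder[of K 0]
  by (intro prob_spaceI) (simp add: space_play_measure)


section \<open>Games with a partially controllable observation function\<close>

text \<open>
  The finite sets of states, control actions and sensors are the (finite) types \<open>'s\<close>, \<open>'a\<close>
  and \<open>'i\<close>.
\<close>

record ('s, 'a, 'i) game =
  trans :: "'s \<Rightarrow> 'a \<Rightarrow> 's pmf"
  init :: 's
  cover :: "'i \<Rightarrow> 's set"
  queries :: "'i set set"
  attacks :: "'i set set"
  observations :: "'s set set"
  init_obs :: "'s set"
  final :: "'s set"

definition Obs :: "('s, 'a, 'i) game \<Rightarrow> 's \<Rightarrow> 'i set \<Rightarrow> 'i set \<Rightarrow> 's set" where
  "Obs G s \<sigma> \<beta> =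
     UNIV - ((\<Union>i\<in>{i \<in> \<sigma> - \<beta>. s \<in> cover G i}. UNIV - cover G i)
             \<union> (\<Union>i\<in>{i \<in> \<sigma> - \<beta>. s \<notin> cover G i}. cover G i))"

definition valid_game :: "('s, 'a, 'i) game \<Rightarrow> bool" where
  "valid_game G \<longleftrightarrow>
     init G \<in> init_obs G \<and> init_obs G \<in> observations G \<and>
     (\<forall>s. \<forall>\<sigma>\<in>queries G. \<forall>\<beta>\<in>attacks G. Obs G s \<sigma> \<beta> \<in> observations G)"

definition Post :: "('s, 'a, 'i) game \<Rightarrow> 's set \<Rightarrow> 'a \<Rightarrow> 's set" where
  "Post G B a = {s'. \<exists>s\<in>B. pmf (trans G s a) s' > 0}"


subsection \<open>Plays\<close>

text \<open>
  The \<open>k\<close>-th round \<open>((a\<^sub>k, \<sigma>\<^sub>k), s\<^sub>k\<^sub>+\<^sub>1, \<beta>\<^sub>k)\<close> of a play consists of player 1's choice, the resulting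
  state, and player 2's attack. Player 1 sees \<open>((a\<^sub>k, \<sigma>\<^sub>k), \<beta>\<^sub>k, o\<^sub>k\<^sub>+\<^sub>1)\<close> instead.
\<close>

type_synonym ('s, 'a, 'i) round = "('a \<times> 'i set) \<times> 's \<times> 'i set"
type_synonym ('s, 'a, 'i) view = "('a \<times> 'i set) \<times> 'i set \<times> 's set"

type_synonym ('s, 'a, 'i) strategy1 = "('s, 'a, 'i) view list \<Rightarrow> ('a \<times> 'i set) pmf"
type_synonym ('s, 'a, 'i) strategy2 =
  "('s, 'a, 'i) round list \<Rightarrow> 'a \<times> 'i set \<Rightarrow> 's \<Rightarrow> 'i set pmf"

definition round_view :: "('s, 'a, 'i) game \<Rightarrow> ('s, 'a, 'i) round \<Rightarrow> ('s, 'a, 'i) view" where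
  "round_view G = (\<lambda>((a, \<sigma>), s', \<beta>). ((a, \<sigma>), \<beta>, Obs G s' \<sigma> \<beta>))"

definition belief :: "('s, 'a, 'i) game \<Rightarrow> ('s, 'a, 'i) view list \<Rightarrow> 's set" where
  "belief G v = foldl (\<lambda>B ((a, \<sigma>), \<beta>, ob). Post G B a \<inter> ob) (init_obs G) v"

definition current_state :: "('s, 'a, 'i) game \<Rightarrow> ('s, 'a, 'i) round list \<Rightarrow> 's" where
  "current_state G h = (if h = [] then init G else fst (snd (last h)))"

definition valid_strategy2 ::
    "('s, 'a, 'i) game \<Rightarrow> ('s, 'a, 'i) strategy2 \<Rightarrow> bool" where
  "valid_strategy2 G \<pi>\<^sub>2 \<longleftrightarrow> (\<forall>h c s'. set_pmf (\<pi>\<^sub>2 h c s') \<subseteq> attacks G)"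

definition round_kernel ::
    "('s, 'a, 'i) game \<Rightarrow> ('s, 'a, 'i) strategy1 \<Rightarrow> ('s, 'a, 'i) strategy2
      \<Rightarrow> ('s, 'a, 'i) round list \<Rightarrow> ('s, 'a, 'i) round pmf" where
  "round_kernel G \<pi>\<^sub>1 \<pi>\<^sub>2 h =
     bind_pmf (\<pi>\<^sub>1 (map (round_view G) h)) (\<lambda>c.
     bind_pmf (trans G (current_state G h) (fst c)) (\<lambda>s'.
     bind_pmf (\<pi>\<^sub>2 h c s') (\<lambda>\<beta>.
     return_pmf (c, s', \<beta>))))"

definition state_at ::
    "('s, 'a, 'i) game \<Rightarrow> (nat \<Rightarrow> ('s, 'a, 'i) round) \<Rightarrow> nat \<Rightarrow> 's" where
  "state_at G \<omega> k = current_state G (map \<omega> [0..<k])"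

definition almost_surely_visits_final ::
    "('s::finite, 'a::finite, 'i::finite) game \<Rightarrow> ('s, 'a, 'i) strategy1 \<Rightarrow> bool" where
  "almost_surely_visits_final G \<pi>\<^sub>1 \<longleftrightarrow>
     (\<forall>\<pi>\<^sub>2. valid_strategy2 G \<pi>\<^sub>2 \<longrightarrow>
        \<P>(\<omega> in play_measure (round_kernel G \<pi>\<^sub>1 \<pi>\<^sub>2). \<exists>k. state_at G \<omega> k \<in> final G) = 1)"


section \<open>The belief-augmented game\<close>

datatype ('s, 'a, 'i) aug_state =
    P1_State 's "'s set"
  | Nature_State 's "'s set" 'a "'i set"
  | P2_State 's "'s set" "'i set"
  | Final_State

text \<open>\<open>Idle\<close> labels the steps out of nature's states and out of the absorbing final state.\<close>

datatype ('a, 'i) move = Control 'a "'i set" | Attack "'i set" | Idle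

instance aug_state :: (finite, finite, finite) finite
proof
  have "(UNIV :: ('a, 'b, 'c) aug_state set)
      \<subseteq> (\<lambda>(s, B). P1_State s B) ` UNIV \<union> (\<lambda>(s, B, a, \<sigma>). Nature_State s B a \<sigma>) ` UNIV
        \<union> (\<lambda>(s, B, \<sigma>). P2_State s B \<sigma>) ` UNIV \<union> {Final_State}"
  proof
    fix q :: "('a, 'b, 'c) aug_state"
    show "q \<in> (\<lambda>(s, B). P1_State s B) ` UNIV \<union> (\<lambda>(s, B, a, \<sigma>). Nature_State s B a \<sigma>) ` UNIV
        \<union> (\<lambda>(s, B, \<sigma>). P2_State s B \<sigma>) ` UNIV \<union> {Final_State}"
      by (cases q) (auto simp: image_iff)
  qed
  then show "finite (UNIV :: ('a, 'b, 'c) aug_state set)"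
    by (rule finite_subset) simp
qed

instance move :: (finite, finite) finite
proof
  have "(UNIV :: ('a, 'b) move set)
      \<subseteq> (\<lambda>(a, \<sigma>). Control a \<sigma>) ` UNIV \<union> range Attack \<union> {Idle}"
  proof
    fix m :: "('a, 'b) move"
    show "m \<in> (\<lambda>(a, \<sigma>). Control a \<sigma>) ` UNIV \<union> range Attack \<union> {Idle}"
      by (cases m) (auto simp: image_iff)
  qed
  then show "finite (UNIV :: ('a, 'b) move set)"
    by (rule finite_subset) simp
qed

text \<open>
  When both \<open>F\<close> and its complement can be reached, only the probability \<open>\<epsilon>\<close> of the final state and
  the support of the remaining mass are prescribed, so \<open>\<delta>\<close> is specified by a predicate.
\<close>

definition augmented_transition ::
    "('s, 'a, 'i) game \<Rightarrow> real
      \<Rightarrow> (('s, 'a, 'i) aug_state \<Rightarrow> ('a, 'i) move \<Rightarrow> ('s, 'a, 'i) aug_state pmf) \<Rightarrow> bool" where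
  "augmented_transition G \<epsilon> \<delta> \<longleftrightarrow>
     (\<forall>s B a. \<forall>\<sigma>\<in>queries G.
        \<delta> (P1_State s B) (Control a \<sigma>) = return_pmf (Nature_State s (Post G B a) a \<sigma>)) \<and>
     (\<forall>s B' a. \<forall>\<sigma>\<in>queries G.
        (Post G {s} a \<subseteq> final G \<longrightarrow>
           \<delta> (Nature_State s B' a \<sigma>) Idle = return_pmf Final_State) \<and>
        (Post G {s} a \<inter> final G = {} \<longrightarrow>
           \<delta> (Nature_State s B' a \<sigma>) Idle = map_pmf (\<lambda>s'. P2_State s' B' \<sigma>) (trans G s a)) \<and>
        (Post G {s} a \<inter> final G \<noteq> {} \<and> Post G {s} a - final G \<noteq> {} \<longrightarrow>
           pmf (\<delta> (Nature_State s B' a \<sigma>) Idle) Final_State = \<epsilon> \<and>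
           set_pmf (\<delta> (Nature_State s B' a \<sigma>) Idle) =
             insert Final_State ((\<lambda>s'. P2_State s' B' \<sigma>) ` (Post G {s} a - final G)))) \<and>
     (\<forall>s' B'. \<forall>\<sigma>\<in>queries G. \<forall>\<beta>\<in>attacks G.
        \<delta> (P2_State s' B' \<sigma>) (Attack \<beta>) = return_pmf (P1_State s' (B' \<inter> Obs G s' \<sigma> \<beta>))) \<and>
     \<delta> Final_State Idle = return_pmf Final_State"


subsection \<open>Plays\<close>

text \<open>
  A play from \<open>q\<close> is recorded as the sequence of moves, each paired with the state it leads to.
\<close>

type_synonym ('s, 'a, 'i) aug_event = "('a, 'i) move \<times> ('s, 'a, 'i) aug_state"

type_synonym ('s, 'a, 'i) aug_strategy1 = "'s \<times> 's set \<Rightarrow> ('a \<times> 'i set) pmf"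
type_synonym ('s, 'a, 'i) aug_strategy2 = "('s, 'a, 'i) aug_event list \<Rightarrow> 'i set pmf"

definition aug_current_state ::
    "('s, 'a, 'i) aug_state \<Rightarrow> ('s, 'a, 'i) aug_event list \<Rightarrow> ('s, 'a, 'i) aug_state" where
  "aug_current_state q h = (if h = [] then q else snd (last h))"

definition valid_aug_strategy1 ::
    "('s, 'a, 'i) game \<Rightarrow> ('s, 'a, 'i) aug_strategy1 \<Rightarrow> bool" where
  "valid_aug_strategy1 G \<pi>\<^sub>1 \<longleftrightarrow> (\<forall>q. set_pmf (\<pi>\<^sub>1 q) \<subseteq> UNIV \<times> queries G)"

definition valid_aug_strategy2 ::
    "('s, 'a, 'i) game \<Rightarrow> ('s, 'a, 'i) aug_strategy2 \<Rightarrow> bool" where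
  "valid_aug_strategy2 G \<pi>\<^sub>2 \<longleftrightarrow> (\<forall>h. set_pmf (\<pi>\<^sub>2 h) \<subseteq> attacks G)"

definition aug_move ::
    "('s, 'a, 'i) aug_strategy1 \<Rightarrow> ('s, 'a, 'i) aug_strategy2 \<Rightarrow> ('s, 'a, 'i) aug_state
      \<Rightarrow> ('s, 'a, 'i) aug_event list \<Rightarrow> ('a, 'i) move pmf" where
  "aug_move \<pi>\<^sub>1 \<pi>\<^sub>2 q h =
     (case aug_current_state q h of
        P1_State s B \<Rightarrow> map_pmf (\<lambda>(a, \<sigma>). Control a \<sigma>) (\<pi>\<^sub>1 (s, B))
      | P2_State s' B' \<sigma> \<Rightarrow> map_pmf Attack (\<pi>\<^sub>2 h)
      | _ \<Rightarrow> return_pmf Idle)"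

definition aug_kernel ::
    "(('s, 'a, 'i) aug_state \<Rightarrow> ('a, 'i) move \<Rightarrow> ('s, 'a, 'i) aug_state pmf)
      \<Rightarrow> ('s, 'a, 'i) aug_strategy1 \<Rightarrow> ('s, 'a, 'i) aug_strategy2 \<Rightarrow> ('s, 'a, 'i) aug_state
      \<Rightarrow> ('s, 'a, 'i) aug_event list \<Rightarrow> ('s, 'a, 'i) aug_event pmf" where
  "aug_kernel \<delta> \<pi>\<^sub>1 \<pi>\<^sub>2 q h =
     bind_pmf (aug_move \<pi>\<^sub>1 \<pi>\<^sub>2 q h) (\<lambda>m. map_pmf (Pair m) (\<delta> (aug_current_state q h) m))"

definition aug_state_at ::
    "('s, 'a, 'i) aug_state \<Rightarrow> (nat \<Rightarrow> ('s, 'a, 'i) aug_event) \<Rightarrow> nat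
      \<Rightarrow> ('s, 'a, 'i) aug_state" where
  "aug_state_at q \<omega> k = aug_current_state q (map \<omega> [0..<k])"

definition almost_sure_winning ::
    "('s::finite, 'a::finite, 'i::finite) game
      \<Rightarrow> (('s, 'a, 'i) aug_state \<Rightarrow> ('a, 'i) move \<Rightarrow> ('s, 'a, 'i) aug_state pmf)
      \<Rightarrow> ('s, 'a, 'i) aug_strategy1 \<Rightarrow> ('s, 'a, 'i) aug_state \<Rightarrow> bool" where
  "almost_sure_winning G \<delta> \<pi>\<^sub>1 q \<longleftrightarrow>
     (\<forall>\<pi>\<^sub>2. valid_aug_strategy2 G \<pi>\<^sub>2 \<longrightarrow>
        \<P>(\<omega> in play_measure (aug_kernel \<delta> \<pi>\<^sub>1 \<pi>\<^sub>2 q). \<exists>k. aug_state_at q \<omega> k = Final_State) = 1)"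


subsection \<open>Belief-based strategies\<close>

definition belief_based :: "('s, 'a, 'i) aug_strategy1 \<Rightarrow> bool" where
  "belief_based \<pi>\<^sub>1 \<longleftrightarrow> (\<forall>s B s' B'. B = B' \<longrightarrow> \<pi>\<^sub>1 (s, B) = \<pi>\<^sub>1 (s', B'))"

text \<open>The strategy in the original game that plays a belief-based \<open>\<pi>\<^sub>1\<close> along the current belief.\<close>

definition play_by_belief ::
    "('s, 'a, 'i) game \<Rightarrow> ('s, 'a, 'i) aug_strategy1 \<Rightarrow> ('s, 'a, 'i) strategy1" where
  "play_by_belief G \<pi>\<^sub>1 v = (THE d. \<forall>s. \<pi>\<^sub>1 (s, belief G v) = d)"

end

theory Submission
  imports Defs
begin

text \<open>
  The two games use different probabilities: when a transition may lead into \<open>F\<close> but need not,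
  the augmented game reaches \<open>Final_State\<close> with some arbitrary probability \<open>\<epsilon>\<close>, and distributes
  the remaining mass arbitrarily over the right support. The theorem holds nevertheless,
  because against a memoryless strategy on finitely many positions almost-sure reachability
  depends on the supports only. A position is a pair \<open>(s, B)\<close> of a state and a belief.

  Against \<open>\<pi>\<^sub>1\<close>, call a position trapped if player 2 can choose attacks so that, for every
  choice that \<open>\<pi>\<^sub>1\<close> can make and every possible transition, the play stays away from \<open>F\<close> and
  in trapped positions. Being trapped is the complement of a least fixed point, whose stages
  (\<open>forces_within\<close>) assign to every position that is not trapped a rank: some choice that \<open>\<pi>\<^sub>1\<close>
  can make has a possible successor state that lies in \<open>F\<close> or, whatever player 2 then does,
  leads to a lower rank (\<open>untrapped_progress\<close>).

  If \<open>\<pi>\<^sub>1\<close> wins the augmented game almost surely, no trapped position can be reached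
  (\<open>reachable_not_trapped\<close>). Otherwise player 2 could attack uniformly at random until a trap is
  within reach, then enter it and stay there. With positive probability this leads to a trap by
  some finite history, after which \<open>Final_State\<close> is never visited.

  In the original game, every possible history that has not visited \<open>F\<close> ends in a reachable position
  (\<open>reachable_position\<close>), since both games allow the same moves outside \<open>F\<close>. Hence this position
  has a rank, and the next round visits \<open>F\<close> or lowers the rank with a probability that is at least
  the smallest positive probability of a choice and a transition. Such a uniform chance of
  progress of a bounded rank forces an almost sure visit (\<open>AE_reach_of_rank_progress\<close>).
\<close>

section \<open>Finite histories of a random play\<close>

primrec history_pmf :: "('p list \<Rightarrow> 'p pmf) \<Rightarrow> nat \<Rightarrow> 'p list pmf" where
  "history_pmf K 0 = return_pmf []"
| "history_pmf K (Suc n) = bind_pmf (history_pmf K n) (\<lambda>h. map_pmf (\<lambda>x. h @ [x]) (K h))"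

lemma length_history: "h \<in> set_pmf (history_pmf K n) \<Longrightarrow> length h = n"
  by (induction n arbitrary: h) auto

lemma snoc_in_history_iff:
  "h @ [x] \<in> set_pmf (history_pmf K (Suc n)) \<longleftrightarrow>
     h \<in> set_pmf (history_pmf K n) \<and> x \<in> set_pmf (K h)"
  by auto

lemma pmf_history:
  "length h = n \<Longrightarrow> pmf (history_pmf K n) h = (\<Prod>i<n. pmf (K (take i h)) (h ! i))"
proof (induction n arbitrary: h)
  case 0
  then show ?case by simp
next
  case (Suc n)
  then obtain g x where h: "h = g @ [x]" and g: "length g = n"
    by (metis length_Suc_conv_rev)
  have "pmf (map_pmf (\<lambda>y. u @ [y]) (K u)) h = indicator {g} u * pmf (K g) x" for u
  proof (cases "u = g")
    case True
    have "inj (\<lambda>y. g @ [y])" by (auto simp: inj_def)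
    from pmf_map_inj'[OF this, of "K g" x] show ?thesis by (simp add: h True)
  next
    case False
    then show ?thesis by (auto simp: h pmf_eq_0_set_pmf)
  qed
  then have "pmf (history_pmf K (Suc n)) h = pmf (history_pmf K n) g * pmf (K g) x"
    by (simp add: pmf_bind measure_pmf_single)
  also have "\<dots> = (\<Prod>i<Suc n. pmf (K (take i h)) (h ! i))"
    using Suc.IH[OF g] g by (simp add: h nth_append)
  finally show ?case .
qed

lemma measurable_history [measurable]:
  "(\<lambda>\<omega>. map \<omega> [0..<n]) \<in> measurable (play_measure K) (count_space (UNIV :: 'p::countable list set))"
proof (rule measurable_count_space_eq2_countable[THEN iffD2], safe)
  fix h :: "'p list"
  have "{\<omega> \<in> space (PiM UNIV (\<lambda>_::nat. count_space (UNIV::'p set))). \<forall>i\<in>{..<n}. \<omega> i = p i}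
      \<in> sets (PiM UNIV (\<lambda>_. count_space UNIV))" for p
    by measurable
  then have *: "{\<omega>. \<forall>i\<in>{..<n}. \<omega> i = p i} \<in> sets (play_measure K)" for p
    by (simp add: sets_play_measure space_PiM)
  have "map \<omega> [0..<n] = h \<longleftrightarrow> length h = n \<and> (\<forall>i\<in>{..<n}. \<omega> i = h ! i)" for \<omega>
    unfolding list_eq_iff_nth_eq by force
  then have "(\<lambda>\<omega>. map \<omega> [0..<n]) -` {h} \<inter> space (play_measure K)
      = (if length h = n then {\<omega>. \<forall>i\<in>{..<n}. \<omega> i = h ! i} else {})"
    unfolding space_play_measure vimage_def by simp
  then show "(\<lambda>\<omega>. map \<omega> [0..<n]) -` {h} \<inter> space (play_measure K) \<in> sets (play_measure K)"
    using *[of "(!) h"] by (cases "length h = n") simp_all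
qed auto

text \<open>
  Through this identity, statements about finitely many rounds become computations with
  discrete distributions.
\<close>

lemma distr_history:
  "distr (play_measure K) (count_space UNIV) (\<lambda>\<omega>. map \<omega> [0..<n])
     = measure_pmf (history_pmf K n)"
proof (rule measure_eqI_countable[where A = UNIV])
  fix h :: "'a list"
  have "emeasure (distr (play_measure K) (count_space UNIV) (\<lambda>\<omega>. map \<omega> [0..<n])) {h}
      = emeasure (play_measure K) {\<omega>. map \<omega> [0..<n] = h}"
    by (subst emeasure_distr) (auto simp: space_play_measure vimage_def)
  also have "\<dots> = emeasure (measure_pmf (history_pmf K n)) {h}"
  proof (cases "length h = n")
    case True
    then have "{\<omega>. map \<omega> [0..<n] = h} = {\<omega>. \<forall>i<n. \<omega> i = h ! i}"
      by (auto simp: list_eq_iff_nth_eq)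
    moreover have "map ((!) h) [0..<i] = take i h" if "i < n" for i
      using that True by (simp add: list_eq_iff_nth_eq)
    ultimately show ?thesis
      using True
      by (simp add: emeasure_play_measure_cylinder emeasure_pmf_single pmf_history prod_ennreal)
  next
    case False
    then have "{\<omega>. map \<omega> [0..<n] = h} = {}" by auto
    moreover have "pmf (history_pmf K n) h = 0"
      using False length_history by (fastforce simp: pmf_eq_0_set_pmf)
    ultimately show ?thesis by (simp add: emeasure_pmf_single)
  qed
  finally show "emeasure (distr (play_measure K) (count_space UNIV) (\<lambda>\<omega>. map \<omega> [0..<n])) {h}
      = emeasure (measure_pmf (history_pmf K n)) {h}" .
qed auto

lemma emeasure_history:
  "emeasure (play_measure K) {\<omega>. P (map \<omega> [0..<n])}
     = emeasure (measure_pmf (history_pmf K n)) {h. P h}"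
  unfolding distr_history[symmetric]
  by (subst emeasure_distr) (auto simp: space_play_measure vimage_def)

text \<open>
  Only countably many finite histories exist, so those of probability zero can be
  ignored all at once.
\<close>

lemma AE_history_possible:
  "AE \<omega> in play_measure K. \<forall>n. map \<omega> [0..<n] \<in> set_pmf (history_pmf K n)"
proof -
  have "AE \<omega> in play_measure K. map \<omega> [0..<n] \<in> set_pmf (history_pmf K n)" for n
  proof -
    have "AE h in distr (play_measure K) (count_space UNIV) (\<lambda>\<omega>. map \<omega> [0..<n]).
        h \<in> set_pmf (history_pmf K n)"
      unfolding distr_history by (rule AE_measure_pmf)
    then show ?thesis by (subst (asm) AE_distr_iff) auto
  qed
  then show ?thesis by (simp add: AE_all_countable)
qed

lemma prob_play_eq_1_iff:
  "\<P>(\<omega> in play_measure K. \<exists>n. P (map \<omega> [0..<n])) = 1 \<longleftrightarrow>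
     (AE \<omega> in play_measure K. \<exists>n. P (map \<omega> [0..<n]))"
proof -
  interpret prob_space "play_measure K" by (rule prob_space_play_measure)
  show ?thesis by (rule prob_Collect_eq_1) measurable
qed

section \<open>Almost-sure reachability from a bounded rank\<close>

text \<open>
  The potential of a history is \<open>0\<close> once the target is reached and \<open>1 - d\<^bsup>r+1\<^esup>\<close> at rank \<open>r\<close>.
  Geometric weights make a single step contract in expectation, so that several consecutive
  steps never have to be considered together: from rank \<open>m\<close>, the potential falls to at most
  \<open>1 - d\<^bsup>m\<^esup>\<close> with probability at least \<open>d\<close>, and even when the rank jumps up to \<open>N\<close> it does not
  exceed \<open>1 - d\<^bsup>N+1\<^esup>\<close>. The mean is then at most
  \<open>d (1 - d\<^bsup>m\<^esup>) + (1 - d) (1 - d\<^bsup>N+1\<^esup>) = (1 - d\<^bsup>m+1\<^esup>) - (1 - d) d\<^bsup>N+1\<^esup>\<close>.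
\<close>

lemma rank_progress_contraction:
  fixes N :: nat and r :: "'x \<Rightarrow> nat" and D :: "'x pmf"
  assumes d: "0 < d" "d \<le> 1/2"
    and bound: "\<And>x. r x \<le> N" and m: "m \<le> N"
    and progress: "d \<le> measure_pmf.prob D {x. T x \<or> r x < m}"
  shows "(\<integral>\<^sup>+x. ennreal (if T x then 0 else 1 - d ^ Suc (r x)) \<partial>D)
    \<le> ennreal ((1 - (1 - d) * d ^ Suc N) * (1 - d ^ Suc m))"
proof -
  let ?A = "{x. T x \<or> r x < m}"
  define k where "k = d ^ m - d ^ Suc N"
  have anti: "d ^ j \<le> d ^ i" if "i \<le> j" for i j :: nat
    using d that by (intro power_decreasing) auto
  have k: "0 \<le> k" using anti[of m "Suc N"] m by (simp add: k_def)
  \<comment> \<open>The bound for rank \<open>N\<close>, lowered on the event of progress to the bound for rank \<open>m - 1\<close>.\<close>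
  have pw: "(if T x then 0 else 1 - d ^ Suc (r x)) \<le> 1 - d ^ Suc N - k * indicator ?A x" for x
    using anti[of "Suc (r x)" "Suc N"] anti[of "Suc (r x)" m] anti[of 0 m] anti[of 0 "Suc N"] bound[of x]
    by (auto simp: k_def indicator_def simp del: power_Suc)
  have nonneg: "0 \<le> 1 - d ^ Suc N - k * indicator ?A x" for x
    using anti[of 0 m] anti[of 0 "Suc N"]
    by (auto simp: k_def indicator_def simp del: power_Suc)
  have "(\<integral>\<^sup>+x. ennreal (if T x then 0 else 1 - d ^ Suc (r x)) \<partial>D)
      \<le> (\<integral>\<^sup>+x. ennreal (1 - d ^ Suc N - k * indicator ?A x) \<partial>D)"
    by (intro nn_integral_mono ennreal_leI pw)
  also have "\<dots> = ennreal (\<integral>x. (1 - d ^ Suc N - k * indicator ?A x) \<partial>D)"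
  proof (intro nn_integral_eq_integral measure_pmf.integrable_const_bound[where B = 1] AE_pmfI)
    fix x
    have "0 \<le> d ^ Suc N + k * indicator ?A x" using d k by (simp add: indicator_def)
    then show "norm (1 - d ^ Suc N - k * indicator ?A x) \<le> 1" using nonneg[of x] by simp
  qed (use nonneg in auto)
  also have "(\<integral>x. (1 - d ^ Suc N - k * indicator ?A x) \<partial>D)
      = 1 - d ^ Suc N - k * measure_pmf.prob D ?A"
    by (subst Bochner_Integration.integral_diff)
       (auto intro!: measure_pmf.integrable_const_bound[where B = 1] simp: measure_pmf.prob_space)
  also have "1 - d ^ Suc N - k * measure_pmf.prob D ?A \<le> 1 - d ^ Suc N - k * d"
    using mult_left_mono[OF progress k] by simp
  also have "\<dots> = (1 - d ^ Suc m) - (1 - d) * d ^ Suc N"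
    by (simp add: k_def algebra_simps)
  also have "\<dots> \<le> (1 - (1 - d) * d ^ Suc N) * (1 - d ^ Suc m)"
  proof -
    have "0 \<le> (1 - d) * d ^ Suc N * d ^ Suc m" using d by simp
    then show ?thesis by (simp add: algebra_simps)
  qed
  finally show ?thesis by (simp add: ennreal_leI)
qed

text \<open>
  The expected potential decays geometrically, while a history that has not reached the target
  keeps a potential of at least \<open>1 / 2\<close>. So the probability of missing the target for \<open>n\<close>
  rounds tends to zero.
\<close>

lemma AE_reach_of_rank_progress:
  fixes K :: "'p::countable list \<Rightarrow> 'p pmf" and r :: "'p list \<Rightarrow> nat"
  assumes persistent: "\<And>h x. T h \<Longrightarrow> T (h @ [x])"
    and bound: "\<And>h. r h \<le> N"
    and c: "0 < c"
    and progress: "\<And>n h. h \<in> set_pmf (history_pmf K n) \<Longrightarrow> \<not> T h \<Longrightarrow>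
      c \<le> measure_pmf.prob (K h) {x. T (h @ [x]) \<or> r (h @ [x]) < r h}"
  shows "AE \<omega> in play_measure K. \<exists>n. T (map \<omega> [0..<n])"
proof -
  \<comment> \<open>The cap \<open>1/2\<close> keeps \<open>d\<close> below \<open>1\<close>, which makes the contraction strict, and bounds the potential from below.\<close>
  define d where "d = min c (1/2)"
  have d: "0 < d" "d \<le> 1/2" "d \<le> c" using c by (auto simp: d_def)
  define g where "g h = (if T h then 0 else 1 - d ^ Suc (r h))" for h
  define q where "q = 1 - (1 - d) * d ^ Suc N"
  have small: "d ^ Suc n \<le> 1/2" for n
    using power_decreasing[of 1 "Suc n" d] d by (simp del: power_Suc)
  have "(1 - d) * d ^ Suc N \<le> 1 * 1"
    using d small[of N] by (intro mult_mono) auto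
  then have q: "0 \<le> q" "q < 1"
    using d by (auto simp: q_def)
  have step: "(\<integral>\<^sup>+x. ennreal (g (h @ [x])) \<partial>K h) \<le> ennreal (q * g h)"
    if h: "h \<in> set_pmf (history_pmf K n)" for h n
  proof (cases "T h")
    case True
    then show ?thesis by (simp add: g_def persistent)
  next
    case False
    have "d \<le> measure_pmf.prob (K h) {x. T (h @ [x]) \<or> r (h @ [x]) < r h}"
      using progress[OF h False] d(3) by linarith
    from rank_progress_contraction[OF d(1,2) bound bound this] show ?thesis
      using False by (simp add: g_def q_def)
  qed
  have potential: "(\<integral>\<^sup>+h. ennreal (g h) \<partial>history_pmf K n) \<le> ennreal (q ^ n)" for n
  proof (induction n)
    case 0
    then show ?case using d by (auto simp: g_def)
  next
    case (Suc n)
    have "(\<integral>\<^sup>+h. ennreal (g h) \<partial>history_pmf K (Suc n))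
        = (\<integral>\<^sup>+h. (\<integral>\<^sup>+x. ennreal (g (h @ [x])) \<partial>K h) \<partial>history_pmf K n)"
      by simp
    also have "\<dots> \<le> (\<integral>\<^sup>+h. ennreal q * ennreal (g h) \<partial>history_pmf K n)"
      using step q by (intro nn_integral_mono_AE AE_pmfI) (simp add: ennreal_mult')
    also have "\<dots> = ennreal q * (\<integral>\<^sup>+h. ennreal (g h) \<partial>history_pmf K n)"
      by (rule nn_integral_cmult) simp
    also have "\<dots> \<le> ennreal q * ennreal (q ^ n)"
      by (intro mult_left_mono Suc.IH) simp
    finally show ?case using q by (simp add: ennreal_mult')
  qed
  have le: "emeasure (play_measure K) {\<omega>. \<forall>n. \<not> T (map \<omega> [0..<n])} \<le> ennreal (2 * q ^ n)" for n
  proof -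
    have "emeasure (play_measure K) {\<omega>. \<forall>n. \<not> T (map \<omega> [0..<n])}
        \<le> emeasure (play_measure K) {\<omega>. \<not> T (map \<omega> [0..<n])}"
    proof (rule emeasure_mono)
      have "Measurable.pred (play_measure K) (\<lambda>\<omega>. \<not> T (map \<omega> [0..<n]))" by measurable
      then show "{\<omega>. \<not> T (map \<omega> [0..<n])} \<in> sets (play_measure K)"
        by (simp add: pred_def space_play_measure)
    qed auto
    also have "\<dots> = (\<integral>\<^sup>+h. indicator {h. \<not> T h} h \<partial>history_pmf K n)"
      by (simp add: emeasure_history[of K "\<lambda>h. \<not> T h"])
    also have "\<dots> \<le> (\<integral>\<^sup>+h. ennreal 2 * ennreal (g h) \<partial>history_pmf K n)"
    proof (intro nn_integral_mono)
      fix h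
      have "1 \<le> 2 * g h" if "\<not> T h" using that small[of "r h"] by (simp add: g_def)
      then have "1 \<le> ennreal (2 * g h)" if "\<not> T h"
        using that by (simp add: ennreal_leI flip: ennreal_1)
      then show "indicator {h. \<not> T h} h \<le> ennreal 2 * ennreal (g h)"
        by (simp add: indicator_def ennreal_mult')
    qed
    also have "\<dots> = ennreal 2 * (\<integral>\<^sup>+h. ennreal (g h) \<partial>history_pmf K n)"
      by (rule nn_integral_cmult) simp
    also have "\<dots> \<le> ennreal 2 * ennreal (q ^ n)"
      by (intro mult_left_mono potential) simp
    finally show ?thesis using q by (simp add: ennreal_mult')
  qed
  have "(\<lambda>n. 2 * q ^ n) \<longlonglongrightarrow> 2 * 0"
    using q by (intro tendsto_intros LIMSEQ_realpow_zero) auto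
  then have "(\<lambda>n. ennreal (2 * q ^ n)) \<longlonglongrightarrow> ennreal 0"
    by (intro tendsto_ennrealI) simp
  then have "emeasure (play_measure K) {\<omega>. \<forall>n. \<not> T (map \<omega> [0..<n])} \<le> 0"
    by (intro LIMSEQ_le_const[where X = "\<lambda>n. ennreal (2 * q ^ n)"]) (auto intro: le)
  moreover have "Measurable.pred (play_measure K) (\<lambda>\<omega>. \<forall>n. \<not> T (map \<omega> [0..<n]))" by measurable
  then have "{\<omega>. \<forall>n. \<not> T (map \<omega> [0..<n])} \<in> sets (play_measure K)"
    by (simp add: pred_def space_play_measure)
  ultimately have "{\<omega>. \<forall>n. \<not> T (map \<omega> [0..<n])} \<in> null_sets (play_measure K)"
    by auto
  then show ?thesis
    by (rule AE_I') auto
qed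

section \<open>Positions that player 2 can keep away from the final states\<close>

definition successor ::
    "('s, 'a, 'i) game \<Rightarrow> 's set \<Rightarrow> 'a \<times> 'i set \<Rightarrow> 's \<Rightarrow> 'i set \<Rightarrow> 's \<times> 's set" where
  "successor G B c s' \<beta> = (s', Post G B (fst c) \<inter> Obs G s' (snd c) \<beta>)"

text \<open>
  These are the stages of an attractor for player 1: player 1 only needs a positive chance, so
  the choice \<open>c\<close> and the state \<open>s'\<close> are existentially quantified. The attack comes after both and
  is player 2's, hence the inner universal quantifier.
\<close>

fun forces_within ::
    "('s, 'a, 'i) game \<Rightarrow> ('s, 'a, 'i) aug_strategy1 \<Rightarrow> nat \<Rightarrow> 's \<times> 's set \<Rightarrow> bool" where
  "forces_within G \<pi>\<^sub>1 0 (s, B) \<longleftrightarrow>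
     (\<exists>c\<in>set_pmf (\<pi>\<^sub>1 (s, B)). Post G {s} (fst c) \<inter> final G \<noteq> {})"
| "forces_within G \<pi>\<^sub>1 (Suc n) (s, B) \<longleftrightarrow>
     (\<exists>c\<in>set_pmf (\<pi>\<^sub>1 (s, B)). \<exists>s'\<in>Post G {s} (fst c). s' \<in> final G \<or>
        (\<forall>\<beta>\<in>attacks G. forces_within G \<pi>\<^sub>1 n (successor G B c s' \<beta>)))"

definition trapped ::
    "('s, 'a, 'i) game \<Rightarrow> ('s, 'a, 'i) aug_strategy1 \<Rightarrow> 's \<times> 's set \<Rightarrow> bool" where
  "trapped G \<pi>\<^sub>1 p \<longleftrightarrow> (\<forall>n. \<not> forces_within G \<pi>\<^sub>1 n p)"

lemma forces_within_mono:
  "forces_within G \<pi>\<^sub>1 m p \<Longrightarrow> m \<le> n \<Longrightarrow> forces_within G \<pi>\<^sub>1 n p"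
proof (induction n arbitrary: m p)
  case 0
  then show ?case by simp
next
  case (Suc n)
  obtain s B where p: "p = (s, B)" by (cases p)
  show ?case
  proof (cases m)
    case 0
    then show ?thesis using Suc.prems p by fastforce
  next
    case (Suc k)
    then obtain c s' where "c \<in> set_pmf (\<pi>\<^sub>1 (s, B))" "s' \<in> Post G {s} (fst c)"
      "s' \<in> final G \<or> (\<forall>\<beta>\<in>attacks G. forces_within G \<pi>\<^sub>1 k (successor G B c s' \<beta>))"
      using Suc.prems(1) p by auto
    moreover have "forces_within G \<pi>\<^sub>1 k p' \<Longrightarrow> forces_within G \<pi>\<^sub>1 n p'" for p'
      using Suc.IH Suc.prems(2) \<open>m = Suc k\<close> by simp
    ultimately show ?thesis unfolding p forces_within.simps by blast
  qed
qed

text \<open>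
  If each of the finitely many attacks led to a stage of the attractor, the largest of these
  stages would contain all the successors, and \<open>(s, B)\<close> would belong to the next one.
\<close>

lemma trapped_escape:
  fixes G :: "('s, 'a, 'i::finite) game"
  assumes "trapped G \<pi>\<^sub>1 (s, B)" and c: "c \<in> set_pmf (\<pi>\<^sub>1 (s, B))"
    and s': "s' \<in> Post G {s} (fst c)"
  shows "s' \<notin> final G \<and> (\<exists>\<beta>\<in>attacks G. trapped G \<pi>\<^sub>1 (successor G B c s' \<beta>))"
proof (rule ccontr)
  assume neg: "\<not> ?thesis"
  show False
  proof (cases "s' \<in> final G")
    case True
    then have "forces_within G \<pi>\<^sub>1 0 (s, B)" using c s' by auto
    then show ?thesis using assms(1) unfolding trapped_def by blast
  next
    case False
    with neg have "\<forall>\<beta>\<in>attacks G. \<exists>n. forces_within G \<pi>\<^sub>1 n (successor G B c s' \<beta>)"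
      by (auto simp: trapped_def)
    then obtain f where f: "\<And>\<beta>. \<beta> \<in> attacks G \<Longrightarrow> forces_within G \<pi>\<^sub>1 (f \<beta>) (successor G B c s' \<beta>)"
      by metis
    have "f \<beta> \<le> Max (range f)" for \<beta> by (rule Max_ge) auto
    then have "\<forall>\<beta>\<in>attacks G. forces_within G \<pi>\<^sub>1 (Max (range f)) (successor G B c s' \<beta>)"
      using f forces_within_mono by blast
    then have "forces_within G \<pi>\<^sub>1 (Suc (Max (range f))) (s, B)"
      unfolding forces_within.simps using c s' by blast
    then show ?thesis using assms(1) unfolding trapped_def by blast
  qed
qed

text \<open>On trapped positions this is an arbitrary number; the plays considered never meet them.\<close>

definition attack_rank ::
    "('s, 'a, 'i) game \<Rightarrow> ('s, 'a, 'i) aug_strategy1 \<Rightarrow> 's \<times> 's set \<Rightarrow> nat" where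
  "attack_rank G \<pi>\<^sub>1 p = (LEAST n. forces_within G \<pi>\<^sub>1 n p)"

lemma untrapped_progress:
  assumes "\<not> trapped G \<pi>\<^sub>1 (s, B)"
  obtains c s' where "c \<in> set_pmf (\<pi>\<^sub>1 (s, B))" "s' \<in> Post G {s} (fst c)"
    "s' \<in> final G \<or>
     (\<forall>\<beta>\<in>attacks G. attack_rank G \<pi>\<^sub>1 (successor G B c s' \<beta>) < attack_rank G \<pi>\<^sub>1 (s, B))"
proof -
  have *: "forces_within G \<pi>\<^sub>1 (attack_rank G \<pi>\<^sub>1 (s, B)) (s, B)"
    using assms unfolding trapped_def attack_rank_def by (auto intro: LeastI)
  show ?thesis
  proof (cases "attack_rank G \<pi>\<^sub>1 (s, B)")
    case 0
    then show ?thesis using * that by auto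
  next
    case (Suc n)
    have le: "attack_rank G \<pi>\<^sub>1 p < Suc n" if "forces_within G \<pi>\<^sub>1 n p" for p
      using that unfolding attack_rank_def by (simp add: less_Suc_eq_le Least_le)
    from * obtain c s' where "c \<in> set_pmf (\<pi>\<^sub>1 (s, B))" "s' \<in> Post G {s} (fst c)"
      "s' \<in> final G \<or> (\<forall>\<beta>\<in>attacks G. forces_within G \<pi>\<^sub>1 n (successor G B c s' \<beta>))"
      unfolding Suc by auto
    with le show ?thesis
      by (intro that[of c s']) (simp_all only: Suc, blast)
  qed
qed

text \<open>
  Both games are compared with this purely combinatorial notion, which mentions no
  probabilities beyond their supports. Transitions into \<open>F\<close> are excluded because they end in
  \<open>Final_State\<close> in the augmented game.
\<close>

inductive reachable ::
    "('s, 'a, 'i) game \<Rightarrow> ('s, 'a, 'i) aug_strategy1 \<Rightarrow> 's \<times> 's set \<Rightarrow> bool"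
  for G :: "('s, 'a, 'i) game" and \<pi>\<^sub>1 where
  init: "reachable G \<pi>\<^sub>1 (init G, init_obs G)"
| step: "reachable G \<pi>\<^sub>1 (s, B) \<Longrightarrow> c \<in> set_pmf (\<pi>\<^sub>1 (s, B)) \<Longrightarrow> s' \<in> Post G {s} (fst c) \<Longrightarrow>
    s' \<notin> final G \<Longrightarrow> \<beta> \<in> attacks G \<Longrightarrow> reachable G \<pi>\<^sub>1 (successor G B c s' \<beta>)"

section \<open>The evading attack strategy in the augmented game\<close>

text \<open>
  The invariant that extends \<open>trapped\<close> to the intermediate nature states and player 2 states.
\<close>

fun safe_state ::
    "('s, 'a, 'i) game \<Rightarrow> ('s, 'a, 'i) aug_strategy1 \<Rightarrow> ('s, 'a, 'i) aug_state \<Rightarrow> bool" where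
  "safe_state G \<pi>\<^sub>1 (P1_State s B) \<longleftrightarrow> trapped G \<pi>\<^sub>1 (s, B)"
| "safe_state G \<pi>\<^sub>1 (Nature_State s B' a \<sigma>) \<longleftrightarrow> \<sigma> \<in> queries G \<and>
     (\<forall>s'\<in>Post G {s} a. s' \<notin> final G \<and>
        (\<exists>\<beta>\<in>attacks G. trapped G \<pi>\<^sub>1 (s', B' \<inter> Obs G s' \<sigma> \<beta>)))"
| "safe_state G \<pi>\<^sub>1 (P2_State s' B' \<sigma>) \<longleftrightarrow> \<sigma> \<in> queries G \<and>
     (\<exists>\<beta>\<in>attacks G. trapped G \<pi>\<^sub>1 (s', B' \<inter> Obs G s' \<sigma> \<beta>))"
| "safe_state G \<pi>\<^sub>1 Final_State \<longleftrightarrow> False"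

text \<open>
  One strategy does both jobs of player 2. Choosing uniformly gives every finite sequence of
  attacks a positive probability, so that every reachable position is attained unless a trap
  is met before; preferring attacks into a trap then preserves safety.
\<close>

definition evading_strategy ::
    "('s, 'a, 'i) game \<Rightarrow> ('s, 'a, 'i) aug_strategy1 \<Rightarrow> ('s, 'a, 'i) aug_state
      \<Rightarrow> ('s, 'a, 'i) aug_strategy2" where
  "evading_strategy G \<pi>\<^sub>1 q h =
     (case aug_current_state q h of
        P2_State s' B' \<sigma> \<Rightarrow>
          (let E = {\<beta> \<in> attacks G. trapped G \<pi>\<^sub>1 (s', B' \<inter> Obs G s' \<sigma> \<beta>)}
           in pmf_of_set (if E = {} then attacks G else E))
      | _ \<Rightarrow> pmf_of_set (attacks G))"

lemma valid_evading_strategy: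
  fixes G :: "('s, 'a, 'i::finite) game"
  assumes "attacks G \<noteq> {}"
  shows "valid_aug_strategy2 G (evading_strategy G \<pi>\<^sub>1 q)"
  unfolding valid_aug_strategy2_def
proof
  fix h
  show "set_pmf (evading_strategy G \<pi>\<^sub>1 q h) \<subseteq> attacks G"
    using assms
    by (cases "aug_current_state q h") (auto simp: evading_strategy_def Let_def split: if_splits)
qed

lemma evading_strategy_P2_State:
  fixes G :: "('s, 'a, 'i::finite) game"
  assumes "attacks G \<noteq> {}" and "aug_current_state q h = P2_State s' B' \<sigma>"
  shows "set_pmf (evading_strategy G \<pi>\<^sub>1 q h) =
    (let E = {\<beta> \<in> attacks G. trapped G \<pi>\<^sub>1 (s', B' \<inter> Obs G s' \<sigma> \<beta>)}
     in if E = {} then attacks G else E)"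
  using assms by (auto simp: evading_strategy_def Let_def)

lemma set_pmf_aug_kernel:
  "set_pmf (aug_kernel \<delta> \<pi>\<^sub>1 \<pi>\<^sub>2 q h) =
     {(m, q'). m \<in> set_pmf (aug_move \<pi>\<^sub>1 \<pi>\<^sub>2 q h) \<and>
        q' \<in> set_pmf (\<delta> (aug_current_state q h) m)}"
  by (auto simp: aug_kernel_def)

lemma aug_current_state_snoc [simp]: "aug_current_state q (h @ [x]) = snd x"
  by (simp add: aug_current_state_def)

text \<open>
  The three kinds of nature states have a common description on the level of supports, in which
  \<open>\<epsilon>\<close> has disappeared.
\<close>

lemma set_pmf_nature:
  assumes "augmented_transition G \<epsilon> \<delta>" and "\<sigma> \<in> queries G"
  shows "set_pmf (\<delta> (Nature_State s B' a \<sigma>) Idle) =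
    (if Post G {s} a \<inter> final G = {} then {} else {Final_State})
      \<union> (\<lambda>s'. P2_State s' B' \<sigma>) ` (Post G {s} a - final G)"
proof -
  have supp: "Post G {s} a = set_pmf (trans G s a)"
    by (auto simp: Post_def set_pmf_iff pmf_positive_iff)
  note nature = assms(1)[unfolded augmented_transition_def, THEN conjunct2, THEN conjunct1,
      rule_format, OF assms(2), of s a B']
  consider "Post G {s} a \<subseteq> final G" | "Post G {s} a \<inter> final G = {}"
    | "Post G {s} a \<inter> final G \<noteq> {}" "Post G {s} a - final G \<noteq> {}"
    by blast
  then show ?thesis
  proof cases
    case 1
    moreover have "Post G {s} a \<noteq> {}" by (simp add: supp set_pmf_not_empty)
    moreover have "set_pmf (\<delta> (Nature_State s B' a \<sigma>) Idle) = {Final_State}"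
      using nature 1 by simp
    ultimately show ?thesis by auto
  next
    case 2
    moreover have "set_pmf (\<delta> (Nature_State s B' a \<sigma>) Idle)
        = (\<lambda>s'. P2_State s' B' \<sigma>) ` Post G {s} a"
      using nature 2 by (simp add: supp)
    moreover have "Post G {s} a - final G = Post G {s} a" using 2 by auto
    ultimately show ?thesis by simp
  next
    case 3
    then show ?thesis using nature by simp
  qed
qed

context
  fixes G :: "('s::finite, 'a::finite, 'i::finite) game"
    and \<epsilon> \<delta> \<pi>\<^sub>1 q K
  assumes trans: "augmented_transition G \<epsilon> \<delta>"
    and valid: "valid_aug_strategy1 G \<pi>\<^sub>1"
    and attacks: "attacks G \<noteq> {}"
  defines "q \<equiv> P1_State (init G) (init_obs G)"
    and "K \<equiv> aug_kernel \<delta> \<pi>\<^sub>1 (evading_strategy G \<pi>\<^sub>1 q) q"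
begin

lemma queries_of_strategy: "(a, \<sigma>) \<in> set_pmf (\<pi>\<^sub>1 p) \<Longrightarrow> \<sigma> \<in> queries G"
  using valid unfolding valid_aug_strategy1_def by blast

lemma delta_P1_State:
  "\<sigma> \<in> queries G \<Longrightarrow>
     \<delta> (P1_State s B) (Control a \<sigma>) = return_pmf (Nature_State s (Post G B a) a \<sigma>)"
  using trans by (simp add: augmented_transition_def)

lemma delta_P2_State:
  "\<sigma> \<in> queries G \<Longrightarrow> \<beta> \<in> attacks G \<Longrightarrow>
     \<delta> (P2_State s' B' \<sigma>) (Attack \<beta>) = return_pmf (P1_State s' (B' \<inter> Obs G s' \<sigma> \<beta>))"
  using trans by (simp add: augmented_transition_def)

lemma delta_Final_State: "\<delta> Final_State Idle = return_pmf Final_State"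
  using trans by (simp add: augmented_transition_def)

lemma safe_state_preserved:
  assumes safe: "safe_state G \<pi>\<^sub>1 (aug_current_state q h)" and x: "x \<in> set_pmf (K h)"
  shows "safe_state G \<pi>\<^sub>1 (snd x)"
proof -
  obtain m q' where [simp]: "x = (m, q')" by (cases x)
  have m: "m \<in> set_pmf (aug_move \<pi>\<^sub>1 (evading_strategy G \<pi>\<^sub>1 q) q h)"
    and q': "q' \<in> set_pmf (\<delta> (aug_current_state q h) m)"
    using x by (auto simp: K_def set_pmf_aug_kernel)
  show ?thesis
  proof (cases "aug_current_state q h")
    case (P1_State s B)
    with m obtain a \<sigma> where c: "(a, \<sigma>) \<in> set_pmf (\<pi>\<^sub>1 (s, B))" and [simp]: "m = Control a \<sigma>"
      by (auto simp: aug_move_def)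
    have "q' = Nature_State s (Post G B a) a \<sigma>"
      using q' P1_State queries_of_strategy[OF c] by (simp add: delta_P1_State)
    then show ?thesis
      using queries_of_strategy[OF c] safe P1_State trapped_escape[of G \<pi>\<^sub>1 s B "(a, \<sigma>)"] c
      by (auto simp: successor_def)
  next
    case (Nature_State s B' a \<sigma>)
    with m have [simp]: "m = Idle" by (simp add: aug_move_def)
    show ?thesis
      using q' safe Nature_State by (auto simp: set_pmf_nature[OF trans] split: if_splits)
  next
    case (P2_State s' B' \<sigma>)
    with m obtain \<beta> where [simp]: "m = Attack \<beta>"
      and "\<beta> \<in> set_pmf (evading_strategy G \<pi>\<^sub>1 q h)"
      by (auto simp: aug_move_def)
    then have "\<beta> \<in> attacks G \<and> trapped G \<pi>\<^sub>1 (s', B' \<inter> Obs G s' \<sigma> \<beta>)"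
      using safe P2_State evading_strategy_P2_State[OF attacks P2_State]
      by (auto simp: Let_def split: if_splits)
    then show ?thesis
      using q' safe P2_State by (simp add: delta_P2_State)
  next
    case Final_State
    then show ?thesis using safe by simp
  qed
qed

lemma final_state_preserved:
  assumes "aug_current_state q h = Final_State" and "x \<in> set_pmf (K h)"
  shows "snd x = Final_State"
  using assms by (auto simp: K_def set_pmf_aug_kernel aug_move_def delta_Final_State)

text \<open>
  The second alternative is unavoidable: the evading strategy may leave the path to \<open>p\<close> as soon
  as some attack leads into a trap. But then the history is already safe, which serves as well.
\<close>

lemma reachable_or_safe_history:
  assumes "reachable G \<pi>\<^sub>1 p"
  shows "\<exists>n. \<exists>h\<in>set_pmf (history_pmf K n).
    aug_current_state q h = P1_State (fst p) (snd p) \<or> safe_state G \<pi>\<^sub>1 (aug_current_state q h)"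
  using assms
proof induction
  case init
  show ?case
    by (rule exI[where x = 0]) (simp add: aug_current_state_def q_def)
next
  case (step s B c s' \<beta>)
  obtain a \<sigma> where [simp]: "c = (a, \<sigma>)" by (cases c)
  have \<sigma>: "\<sigma> \<in> queries G" using step.hyps queries_of_strategy by simp
  obtain n h where h: "h \<in> set_pmf (history_pmf K n)"
    and cases: "aug_current_state q h = P1_State s B \<or> safe_state G \<pi>\<^sub>1 (aug_current_state q h)"
    using step.IH by auto
  from cases show ?case
  proof
    assume safe: "safe_state G \<pi>\<^sub>1 (aug_current_state q h)"
    show ?thesis using h safe by blast
  next
    assume cur: "aug_current_state q h = P1_State s B"
    let ?B = "Post G B a"
    let ?h1 = "h @ [(Control a \<sigma>, Nature_State s ?B a \<sigma>)]"
    let ?h2 = "?h1 @ [(Idle, P2_State s' ?B \<sigma>)]"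
    let ?h3 = "?h2 @ [(Attack \<beta>, P1_State s' (?B \<inter> Obs G s' \<sigma> \<beta>))]"
    have h1: "?h1 \<in> set_pmf (history_pmf K (Suc n))"
      unfolding snoc_in_history_iff using h cur step.hyps \<sigma>
      by (force simp: K_def set_pmf_aug_kernel aug_move_def delta_P1_State)
    have h2: "?h2 \<in> set_pmf (history_pmf K (Suc (Suc n)))"
      unfolding snoc_in_history_iff[of ?h1] using h1 step.hyps \<sigma>
      by (simp add: K_def set_pmf_aug_kernel aug_move_def set_pmf_nature[OF trans] del: history_pmf.simps)
    show ?thesis
    proof (cases "safe_state G \<pi>\<^sub>1 (P2_State s' ?B \<sigma>)")
      case True
      then have "safe_state G \<pi>\<^sub>1 (aug_current_state q ?h2)"
        by (simp only: aug_current_state_snoc snd_conv)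
      then show ?thesis using h2 by blast
    next
      case False
      have cur2: "aug_current_state q ?h2 = P2_State s' ?B \<sigma>"
        by (simp only: aug_current_state_snoc snd_conv)
      have "\<beta> \<in> set_pmf (evading_strategy G \<pi>\<^sub>1 q ?h2)"
        unfolding evading_strategy_P2_State[OF attacks cur2]
        using False \<sigma> \<open>\<beta> \<in> attacks G\<close> by (auto simp: Let_def)
      then have "(Attack \<beta>, P1_State s' (?B \<inter> Obs G s' \<sigma> \<beta>)) \<in> set_pmf (K ?h2)"
        using \<sigma> \<open>\<beta> \<in> attacks G\<close> 
        unfolding K_def set_pmf_aug_kernel aug_move_def cur2 by (simp add: delta_P2_State)
      then have h3: "?h3 \<in> set_pmf (history_pmf K (Suc (Suc (Suc n))))"
        unfolding snoc_in_history_iff[of ?h2] using h2 by blast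
      have "aug_current_state q ?h3
          = P1_State (fst (successor G B c s' \<beta>)) (snd (successor G B c s' \<beta>))"
        by (simp only: aug_current_state_snoc snd_conv) (simp add: successor_def)
      then show ?thesis using h3 by blast
    qed
  qed
qed

text \<open>
  A possible history has positive probability. But if it ends in a safe state, almost no play
  extends it: almost every play visits \<open>Final_State\<close> and remains there, whereas a play that
  extends the history would remain safe, and the two clash at the later of both times.
\<close>

lemma reachable_not_trapped:
  assumes win: "almost_sure_winning G \<delta> \<pi>\<^sub>1 q" and p: "reachable G \<pi>\<^sub>1 p"
  shows "\<not> trapped G \<pi>\<^sub>1 p"
proof
  assume "trapped G \<pi>\<^sub>1 p"
  then obtain n h where h: "h \<in> set_pmf (history_pmf K n)"
    and safe: "safe_state G \<pi>\<^sub>1 (aug_current_state q h)"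
    using reachable_or_safe_history[OF p] by fastforce
  have "AE \<omega> in play_measure K. \<exists>k. aug_current_state q (map \<omega> [0..<k]) = Final_State"
    using win valid_evading_strategy[OF attacks]
    unfolding almost_sure_winning_def aug_state_at_def K_def
    by (subst prob_play_eq_1_iff[symmetric]) blast
  then have "AE \<omega> in play_measure K. map \<omega> [0..<n] \<noteq> h"
    using AE_history_possible
  proof eventually_elim
    case (elim \<omega>)
    obtain k where k: "aug_current_state q (map \<omega> [0..<k]) = Final_State"
      using elim(1) by blast
    have next_event: "\<omega> j \<in> set_pmf (K (map \<omega> [0..<j]))" for j
      using elim(2)[rule_format, of "Suc j"] by auto
    have final_later: "aug_current_state q (map \<omega> [0..<j]) = Final_State" if "k \<le> j" for j
      using that
    proof (induction j rule: dec_induct)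
      case (step j)
      then show ?case using final_state_preserved next_event by simp
    qed (rule k)
    show ?case
    proof
      assume prefix: "map \<omega> [0..<n] = h"
      have "safe_state G \<pi>\<^sub>1 (aug_current_state q (map \<omega> [0..<j]))" if "n \<le> j" for j
        using that
      proof (induction j rule: dec_induct)
        case (step j)
        then show ?case using safe_state_preserved next_event by simp
      qed (simp add: prefix safe)
      from this[of "max k n"] final_later[of "max k n"] show False by simp
    qed
  qed
  moreover have "Measurable.pred (play_measure K) (\<lambda>\<omega>. map \<omega> [0..<n] = h)" by measurable
  then have "{\<omega>. map \<omega> [0..<n] = h} \<in> sets (play_measure K)"
    by (simp add: pred_def space_play_measure)
  ultimately have "emeasure (play_measure K) {\<omega>. map \<omega> [0..<n] = h} = 0"
    by (subst (asm) AE_iff_measurable[OF _ refl]) (simp_all add: space_play_measure)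
  then have "emeasure (measure_pmf (history_pmf K n)) {h} = 0"
    by (simp add: emeasure_history[of K "\<lambda>g. g = h"])
  then show False
    using h by (simp add: emeasure_pmf_single pmf_eq_0_set_pmf)
qed

end

section \<open>Transfer to the original game\<close>

definition position :: "('s, 'a, 'i) game \<Rightarrow> ('s, 'a, 'i) round list \<Rightarrow> 's \<times> 's set" where
  "position G h = (current_state G h, belief G (map (round_view G) h))"

definition visited_final :: "('s, 'a, 'i) game \<Rightarrow> ('s, 'a, 'i) round list \<Rightarrow> bool" where
  "visited_final G h \<longleftrightarrow> (\<exists>k\<le>length h. current_state G (take k h) \<in> final G)"

lemma position_snoc:
  "position G (h @ [(c, s', \<beta>)]) = successor G (snd (position G h)) c s' \<beta>"
  by (cases c) (simp add: position_def successor_def current_state_def belief_def round_view_def)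

lemma visited_final_snoc:
  "visited_final G (h @ [x]) \<longleftrightarrow> visited_final G h \<or> fst (snd x) \<in> final G"
proof -
  have "visited_final G (h @ [x]) \<longleftrightarrow>
      (\<exists>k\<le>length h. current_state G (take k (h @ [x])) \<in> final G) \<or>
      current_state G (take (Suc (length h)) (h @ [x])) \<in> final G"
    unfolding visited_final_def using le_Suc_eq by auto
  also have "(\<exists>k\<le>length h. current_state G (take k (h @ [x])) \<in> final G) \<longleftrightarrow> visited_final G h"
    unfolding visited_final_def by (intro ex_cong1 conj_cong refl) simp
  finally show ?thesis by (simp add: current_state_def)
qed

lemma play_by_belief_eq:
  assumes "belief_based \<pi>\<^sub>1"
  shows "play_by_belief G \<pi>\<^sub>1 (map (round_view G) h) = \<pi>\<^sub>1 (position G h)"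
proof -
  have "(\<forall>s. \<pi>\<^sub>1 (s, belief G (map (round_view G) h)) = d) \<longleftrightarrow> d = \<pi>\<^sub>1 (position G h)" for d
    using assms unfolding belief_based_def position_def by metis
  then show ?thesis unfolding play_by_belief_def by simp
qed

lemma pmf_round_kernel:
  "pmf (round_kernel G \<pi> \<pi>\<^sub>2 h) (c, s', \<beta>) =
     pmf (\<pi> (map (round_view G) h)) c * pmf (trans G (current_state G h) (fst c)) s'
       * pmf (\<pi>\<^sub>2 h c s') \<beta>"
proof -
  have dirac: "pmf (return_pmf (x, y, z)) (c, s', \<beta>)
      = indicator {c} x * indicator {s'} y * indicator {\<beta>} z" for x y z
    by (auto simp: indicator_def)
  have single: "measure_pmf.expectation D (\<lambda>z. k * indicator {z0} z) = k * pmf D z0"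
    for D :: "'x pmf" and k z0
    by (simp add: measure_pmf_single)
  have attack: "measure_pmf.expectation (\<pi>\<^sub>2 h x y) (\<lambda>z. pmf (return_pmf (x, y, z)) (c, s', \<beta>))
      = (indicator {c} x * pmf (\<pi>\<^sub>2 h c s') \<beta>) * indicator {s'} y" for x y
    unfolding dirac single by (simp add: indicator_def)
  have state: "measure_pmf.expectation (trans G (current_state G h) (fst x))
      (\<lambda>y. (indicator {c} x * pmf (\<pi>\<^sub>2 h c s') \<beta>) * indicator {s'} y)
      = (pmf (\<pi>\<^sub>2 h c s') \<beta> * pmf (trans G (current_state G h) (fst c)) s') * indicator {c} x" for x
    unfolding single by (simp add: indicator_def)
  show ?thesis
    unfolding round_kernel_def pmf_bind attack state
    unfolding single by (simp add: mult_ac)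
qed

text \<open>
  A round of the original game updates state and belief as a step of \<open>reachable\<close> does; only
  rounds that enter \<open>F\<close> have no counterpart there.
\<close>

lemma reachable_position:
  assumes bb: "belief_based \<pi>\<^sub>1" and v2: "valid_strategy2 G \<pi>\<^sub>2"
    and "h \<in> set_pmf (history_pmf (round_kernel G (play_by_belief G \<pi>\<^sub>1) \<pi>\<^sub>2) n)"
    and "\<not> visited_final G h"
  shows "reachable G \<pi>\<^sub>1 (position G h)"
  using assms(3,4)
proof (induction n arbitrary: h)
  case 0
  then show ?case
    by (simp add: position_def current_state_def belief_def reachable.init)
next
  case (Suc n)
  let ?K = "round_kernel G (play_by_belief G \<pi>\<^sub>1) \<pi>\<^sub>2"
  from Suc.prems(1) obtain g x where h: "h = g @ [x]"
    and g: "g \<in> set_pmf (history_pmf ?K n)" and x: "x \<in> set_pmf (?K g)"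
    by auto
  obtain c s' \<beta> where [simp]: "x = (c, s', \<beta>)" by (cases x)
  have nv: "\<not> visited_final G g" "s' \<notin> final G"
    using Suc.prems(2) by (auto simp: h visited_final_snoc)
  have c: "c \<in> set_pmf (\<pi>\<^sub>1 (position G g))"
    and s': "s' \<in> Post G {current_state G g} (fst c)"
    and "\<beta> \<in> set_pmf (\<pi>\<^sub>2 g c s')"
    using x
    by (auto simp: round_kernel_def play_by_belief_eq[OF bb] Post_def pmf_positive_iff)
  then have \<beta>: "\<beta> \<in> attacks G"
    using v2 unfolding valid_strategy2_def by blast
  show ?case
    using reachable.step[of G \<pi>\<^sub>1 "current_state G g" "snd (position G g)" c s' \<beta>]
      Suc.IH[OF g nv(1)] c s' \<beta> nv(2)
    by (simp add: h position_snoc) (simp add: position_def)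
qed

lemma finite_min_positive:
  fixes f :: "'x::finite \<Rightarrow> real"
  obtains c where "0 < c" and "\<And>x. 0 < f x \<Longrightarrow> c \<le> f x"
proof
  let ?S = "insert 1 (f ` {x. 0 < f x})"
  show "0 < Min ?S" by (subst Min_gr_iff) auto
  show "\<And>x. 0 < f x \<Longrightarrow> Min ?S \<le> f x" by (rule Min_le) auto
qed

theorem theorem1:
  fixes G :: "('s::finite, 'a::finite, 'i::finite) game"
    and \<epsilon> :: real
    and \<delta> :: "('s, 'a, 'i) aug_state \<Rightarrow> ('a, 'i) move \<Rightarrow> ('s, 'a, 'i) aug_state pmf"
    and \<pi>\<^sub>1 :: "('s, 'a, 'i) aug_strategy1"
  assumes "valid_game G"
    and "0 < \<epsilon>" and "\<epsilon> < 1"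
    and "augmented_transition G \<epsilon> \<delta>"
    and "valid_aug_strategy1 G \<pi>\<^sub>1"
    and "belief_based \<pi>\<^sub>1"
    and "almost_sure_winning G \<delta> \<pi>\<^sub>1 (P1_State (init G) (init_obs G))"
  shows "almost_surely_visits_final G (play_by_belief G \<pi>\<^sub>1)"
  unfolding almost_surely_visits_final_def
proof (intro allI impI)
  fix \<pi>\<^sub>2 :: "('s, 'a, 'i) strategy2"
  assume v2: "valid_strategy2 G \<pi>\<^sub>2"
  then have attacks: "attacks G \<noteq> {}"
    using set_pmf_not_empty by (fastforce simp: valid_strategy2_def)
  let ?K = "round_kernel G (play_by_belief G \<pi>\<^sub>1) \<pi>\<^sub>2"
  let ?rank = "attack_rank G \<pi>\<^sub>1"
  define w where "w = (\<lambda>(p, c, s'). pmf (\<pi>\<^sub>1 p) c * pmf (trans G (fst p) (fst c)) s')"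
  obtain \<eta> where \<eta>: "0 < \<eta>" and \<eta>_le: "\<And>x. 0 < w x \<Longrightarrow> \<eta> \<le> w x"
    using finite_min_positive[of w] by blast
  have "AE \<omega> in play_measure ?K. \<exists>n. visited_final G (map \<omega> [0..<n])"
  proof (rule AE_reach_of_rank_progress[where r = "\<lambda>h. ?rank (position G h)"
        and N = "Max (range ?rank)" and c = \<eta>])
    fix n h
    assume h: "h \<in> set_pmf (history_pmf ?K n)" and nv: "\<not> visited_final G h"
    define s B where "s = current_state G h" and "B = snd (position G h)"
    have pos: "position G h = (s, B)" by (simp add: s_def B_def position_def)
    have "\<not> trapped G \<pi>\<^sub>1 (s, B)"
      using reachable_not_trapped[OF assms(4,5) attacks assms(7)]
        reachable_position[OF assms(6) v2 h nv] by (simp add: pos)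
    then obtain c s' where c: "c \<in> set_pmf (\<pi>\<^sub>1 (s, B))" and s': "s' \<in> Post G {s} (fst c)"
      and good: "s' \<in> final G \<or>
        (\<forall>\<beta>\<in>attacks G. ?rank (successor G B c s' \<beta>) < ?rank (s, B))"
      by (rule untrapped_progress)
    let ?A = "{x. visited_final G (h @ [x]) \<or> ?rank (position G (h @ [x])) < ?rank (position G h)}"
    \<comment> \<open>Player 2 attacks after seeing \<open>c\<close> and \<open>s'\<close>, but every attack makes progress, so the attack
      probabilities add up to one and cost nothing.\<close>
    have "\<eta> \<le> pmf (\<pi>\<^sub>1 (s, B)) c * pmf (trans G s (fst c)) s'"
      using \<eta>_le[of "((s, B), c, s')"] c s' by (simp add: w_def Post_def pmf_positive_iff)
    also have "\<dots> = pmf (\<pi>\<^sub>1 (s, B)) c * pmf (trans G s (fst c)) s'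
        * (\<Sum>\<beta>\<in>attacks G. pmf (\<pi>\<^sub>2 h c s') \<beta>)"
      using v2[unfolded valid_strategy2_def, rule_format, of h c s'] by (subst sum_pmf_eq_1) simp_all
    also have "\<dots> = (\<Sum>\<beta>\<in>attacks G. pmf (?K h) (c, s', \<beta>))"
      by (simp add: sum_distrib_left pmf_round_kernel play_by_belief_eq[OF assms(6)] pos s_def)
    also have "\<dots> = (\<Sum>x\<in>(\<lambda>\<beta>. (c, s', \<beta>)) ` attacks G. pmf (?K h) x)"
      by (subst sum.reindex) (auto simp: inj_on_def)
    also have "\<dots> = measure_pmf.prob (?K h) ((\<lambda>\<beta>. (c, s', \<beta>)) ` attacks G)"
      by (simp add: measure_measure_pmf_finite)
    also have "\<dots> \<le> measure_pmf.prob (?K h) ?A"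
      using good by (intro measure_pmf.finite_measure_mono)
        (auto simp: visited_final_snoc position_snoc pos)
    finally show "\<eta> \<le> measure_pmf.prob (?K h) ?A" .
  qed (auto simp: visited_final_snoc \<eta>)
  then have "AE \<omega> in play_measure ?K. \<exists>n. current_state G (map \<omega> [0..<n]) \<in> final G"
  proof eventually_elim
    case (elim \<omega>)
    then show ?case by (auto simp: visited_final_def take_map)
  qed
  then show "\<P>(\<omega> in play_measure ?K. \<exists>k. state_at G \<omega> k \<in> final G) = 1"
    unfolding state_at_def by (subst prob_play_eq_1_iff)
qed

end
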